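(* Let $\theta>0$ be known, $m\in\mathbb{R}$ unknown, $m_0\in\mathbb{R}$, $u>0$, $S>0$ and $h>0$. For the predictors $\widehat{p}_{0,S}$ and $p_S$ of $X_{S+h}$ given $X_{(S)}=(X_t,\,0\le t\le S)$, where $X$ is the stationary Ornstein-Uhlenbeck process with mean $m$ and parameter $\theta$, one has $$\widehat{p}_{0,S}\prec p_S\quad\Longleftrightarrow\quad|m-m_0|\le\Big(\frac{1}{\theta(2+\theta S)}+2u^2\Big)^{1/2},$$ and $|m-m_0|\le u\sqrt{2}$ implies $\widehat{p}_{0,S}\prec p_S$ for all $S>0$. Here $\widehat{p}_{0,S}\prec p_S$ (at the parameter value $m$) means $\mathbb{E}_m(\widehat{p}_{0,S}-X_{S+h})^2\le\mathbb{E}_m(p_S-X_{S+h})^2$.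
   Context: The stationary Ornstein-Uhlenbeck process is $X_t=m+\int_{-\infty}^t e^{-\theta(t-s)}\,dW(s)$, $t\in\mathbb{R}$, with $m\in\mathbb{R}$, $\theta>0$ and $W$ a standard bilateral Wiener process; $\mathbb{E}_m$ denotes expectation when the mean is $m$. Set $Z_S=X_0+X_S+\theta\int_0^S X_t\,dt$. The maximum likelihood estimator of $m$ is $m_S=\dfrac{Z_S}{2+\theta S}$. With prior $\mathcal{N}(m_0,u^2)$ on $m$ (independent of $W$), the Bayesian estimator of $m$ is $$\widehat{m}_S=\frac{Z_S+m_0\theta^{-1}u^{-2}}{2+\theta S+\theta^{-1}u^{-2}}.$$ The unbiased predictor of $X_{S+h}$ associated with the maximum likelihood estimator is $p_S=m_S(1-e^{-\theta h})+e^{-\theta h}X_S$, and the Bayesian predictor is $\widehat{p}_{0,S}=\widehat{m}_S(1-e^{-\theta h})+e^{-\theta h}X_S$. *)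

theory Defs
  imports "HOL-Probability.Probability"
begin

locale bilateral_wiener_process = prob_space M
  for M :: "'a measure" +
  fixes W :: "real \<Rightarrow> 'a \<Rightarrow> real"
  assumes W_measurable: "\<And>t. W t \<in> borel_measurable M"
    and W_zero: "AE \<omega> in M. W 0 \<omega> = 0"
    and W_normal_increments:
      "\<And>s t. s < t \<Longrightarrow>
        distributed M lborel (\<lambda>\<omega>. W t \<omega> - W s \<omega>) (normal_density 0 (sqrt (t - s)))"
    and W_indep_increments:
      "\<And>(n :: nat) (t :: nat \<Rightarrow> real). mono t \<Longrightarrow>
        indep_vars (\<lambda>_. borel) (\<lambda>i \<omega>. W (t (Suc i)) \<omega> - W (t i) \<omega>) {..<n}"
    and W_continuous: "AE \<omega> in M. continuous_on UNIV (\<lambda>t. W t \<omega>)"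

text \<open>
  The Wiener integral over the real line of a deterministic square-integrable function:
  first for step functions, then by mean-square limits. The value is a random variable
  determined up to almost sure equality, so the integral is given as a relation.
\<close>

definition step_function :: "nat \<Rightarrow> (nat \<Rightarrow> real) \<Rightarrow> (nat \<Rightarrow> real) \<Rightarrow> real \<Rightarrow> real" where
  "step_function n t c x = (\<Sum>i<n. c i * indicator {t i<..t (Suc i)} x)"

definition step_wiener_integral ::
  "(real \<Rightarrow> 'a \<Rightarrow> real) \<Rightarrow> nat \<Rightarrow> (nat \<Rightarrow> real) \<Rightarrow> (nat \<Rightarrow> real) \<Rightarrow> 'a \<Rightarrow> real" where
  "step_wiener_integral W n t c \<omega> = (\<Sum>i<n. c i * (W (t (Suc i)) \<omega> - W (t i) \<omega>))"

definition has_wiener_integral ::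
  "'a measure \<Rightarrow> (real \<Rightarrow> 'a \<Rightarrow> real) \<Rightarrow> (real \<Rightarrow> real) \<Rightarrow> ('a \<Rightarrow> real) \<Rightarrow> bool" where
  "has_wiener_integral M W f J \<longleftrightarrow>
     f \<in> borel_measurable lborel \<and> integrable lborel (\<lambda>x. (f x)\<^sup>2) \<and>
     J \<in> borel_measurable M \<and> integrable M (\<lambda>\<omega>. (J \<omega>)\<^sup>2) \<and>
     (\<exists>(n :: nat \<Rightarrow> nat) (t :: nat \<Rightarrow> nat \<Rightarrow> real) (c :: nat \<Rightarrow> nat \<Rightarrow> real).
        (\<forall>k. mono (t k)) \<and>
        (\<lambda>k. \<integral>x. (step_function (n k) (t k) (c k) x - f x)\<^sup>2 \<partial>lborel) \<longlonglongrightarrow> 0 \<and>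
        (\<lambda>k. \<integral>\<omega>. (step_wiener_integral W (n k) (t k) (c k) \<omega> - J \<omega>)\<^sup>2 \<partial>M) \<longlonglongrightarrow> 0)"

text \<open>
  The Wiener integrals determine each \<open>X t\<close> only almost surely; as usual, \<open>X\<close> is a version
  with continuous paths, so that \<open>\<integral>\<^sub>0\<^sup>S X\<^sub>t dt\<close> is a pathwise integral.
\<close>

locale stationary_OU_process = bilateral_wiener_process M W
  for M :: "'a measure" and W :: "real \<Rightarrow> 'a \<Rightarrow> real" +
  fixes \<theta> m :: real and X :: "real \<Rightarrow> 'a \<Rightarrow> real"
  assumes X_wiener_integral:
      "\<And>t. has_wiener_integral M W
             (\<lambda>s. indicator {..t} s * exp (- \<theta> * (t - s))) (\<lambda>\<omega>. X t \<omega> - m)"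
    and X_continuous: "\<And>\<omega>. \<omega> \<in> space M \<Longrightarrow> continuous_on UNIV (\<lambda>t. X t \<omega>)"

text \<open>
  Estimators and predictors are functionals of an observed path \<open>x\<close>, which they use only
  on \<open>{0..S}\<close>.
\<close>

definition Z_stat :: "real \<Rightarrow> real \<Rightarrow> (real \<Rightarrow> real) \<Rightarrow> real" where
  "Z_stat \<theta> S x = x 0 + x S + \<theta> * (LBINT t:{0..S}. x t)"

definition ml_estimator :: "real \<Rightarrow> real \<Rightarrow> (real \<Rightarrow> real) \<Rightarrow> real" where
  "ml_estimator \<theta> S x = Z_stat \<theta> S x / (2 + \<theta> * S)"

definition bayes_estimator ::
  "real \<Rightarrow> real \<Rightarrow> real \<Rightarrow> real \<Rightarrow> (real \<Rightarrow> real) \<Rightarrow> real" where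
  "bayes_estimator \<theta> m0 u S x =
     (Z_stat \<theta> S x + m0 * inverse \<theta> * inverse (u\<^sup>2)) /
     (2 + \<theta> * S + inverse \<theta> * inverse (u\<^sup>2))"

definition ml_predictor :: "real \<Rightarrow> real \<Rightarrow> real \<Rightarrow> (real \<Rightarrow> real) \<Rightarrow> real" where
  "ml_predictor \<theta> h S x =
     ml_estimator \<theta> S x * (1 - exp (- \<theta> * h)) + exp (- \<theta> * h) * x S"

definition bayes_predictor ::
  "real \<Rightarrow> real \<Rightarrow> real \<Rightarrow> real \<Rightarrow> real \<Rightarrow> (real \<Rightarrow> real) \<Rightarrow> real" where
  "bayes_predictor \<theta> m0 u h S x =
     bayes_estimator \<theta> m0 u S x * (1 - exp (- \<theta> * h)) + exp (- \<theta> * h) * x S"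

text \<open>\<open>preferable M Y p q\<close> is \<open>p \<prec> q\<close> for predictors \<open>p\<close>, \<open>q\<close> of \<open>Y\<close>; the inequality is weak.\<close>

definition preferable ::
  "'a measure \<Rightarrow> ('a \<Rightarrow> real) \<Rightarrow> ('a \<Rightarrow> real) \<Rightarrow> ('a \<Rightarrow> real) \<Rightarrow> bool" where
  "preferable M Y p q \<longleftrightarrow>
     (\<integral>\<omega>. (p \<omega> - Y \<omega>)\<^sup>2 \<partial>M) \<le> (\<integral>\<omega>. (q \<omega> - Y \<omega>)\<^sup>2 \<partial>M)"

end

theory Submission
  imports Defs
begin

text \<open>
  Only first and second moments matter. Write \<open>Y\<^sub>t = X\<^sub>t - m\<close>, \<open>D = 2 + \<theta> S\<close>, \<open>c = 1 / (\<theta> u\<^sup>2)\<close>,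
  \<open>N = Y\<^sub>0 + Y\<^sub>S + \<theta> \<integral>\<^sub>0\<^sup>S Y\<^sub>t dt\<close> and \<open>R = Y\<^sub>S\<^sub>+\<^sub>h - exp (- \<theta> h) Y\<^sub>S\<close>. Then \<open>Z\<^sub>S = m D + N\<close>, so with
  \<open>a = 1 - exp (- \<theta> h)\<close> the two prediction errors are
  \<open>(a / D) N - R\<close> for the maximum likelihood predictor and
  \<open>(a / (D + c)) (N + c (m\<^sub>0 - m)) - R\<close> for the Bayesian one.

  The isometry of the Wiener integral gives \<open>E Y\<^sub>s Y\<^sub>t = exp (- \<theta> \<bar>s - t\<bar>) / (2 \<theta>)\<close>. By the exponential
  form of this covariance \<open>R\<close> is uncorrelated with every \<open>Y\<^sub>t\<close>, \<open>t \<le> S\<close>, hence with \<open>N\<close>; therefore \<open>R\<close>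
  adds the same amount \<open>E R\<^sup>2\<close> to both errors. The remaining part needs \<open>E N = 0\<close> and \<open>E N\<^sup>2 = D / \<theta>\<close>.
  The latter follows from a cancellation: \<open>E Y\<^sub>t N = 1 / \<theta>\<close> for \<^emph>\<open>every\<close> \<open>t\<close> in \<open>[0, S]\<close>
  (\<open>covariance_centred_score\<close>), so \<open>E N\<^sup>2 = (1 + 1 + \<theta> S) / \<theta>\<close>. Since \<open>a \<noteq> 0\<close>, the Bayesian
  predictor is preferable iff \<open>(D / \<theta> + c\<^sup>2 (m - m\<^sub>0)\<^sup>2) / (D + c)\<^sup>2 \<le> 1 / (\<theta> D)\<close>, which rearranges to
  \<open>(m - m\<^sub>0)\<^sup>2 \<le> 1 / (\<theta> D) + 2 / (\<theta> c)\<close>, and \<open>2 / (\<theta> c) = 2 u\<^sup>2\<close>. As \<open>1 / (\<theta> D) > 0\<close>, the bound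
  \<open>\<bar>m - m\<^sub>0\<bar> \<le> u \<surd>2\<close> suffices for all \<open>S\<close> at once.

  The analytic work is in two places: the passage of \<open>L\<^sup>2\<close> limits through inner products
  (\<open>tendsto_integral_mult\<close>), which carries the isometry from step functions to general
  integrands, and the exchange of expectation and time integral
  (\<open>expectation_mult_time_integral\<close>), for which path continuity supplies joint measurability.
\<close>

section \<open>Square-integrable functions\<close>

definition square_integrable :: "'a measure \<Rightarrow> ('a \<Rightarrow> real) \<Rightarrow> bool" where
  "square_integrable M f \<longleftrightarrow> f \<in> borel_measurable M \<and> integrable M (\<lambda>x. (f x)\<^sup>2)"

lemma square_integrable_measurable:
  "square_integrable M f \<Longrightarrow> f \<in> borel_measurable M"
  by (simp add: square_integrable_def)

lemma abs_mult_le_sum_squares: "\<bar>a * b\<bar> \<le> a\<^sup>2 + b\<^sup>2" for a b :: real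
proof -
  have "0 \<le> (\<bar>a\<bar> - \<bar>b\<bar>)\<^sup>2" by simp
  then have "2 * (\<bar>a\<bar> * \<bar>b\<bar>) \<le> a\<^sup>2 + b\<^sup>2" by (simp add: power2_diff)
  moreover have "0 \<le> \<bar>a\<bar> * \<bar>b\<bar>" by simp
  ultimately have "\<bar>a\<bar> * \<bar>b\<bar> \<le> a\<^sup>2 + b\<^sup>2" by linarith
  then show ?thesis by (simp add: abs_mult)
qed

lemma square_integrable_mult:
  assumes "square_integrable M f" "square_integrable M g"
  shows "integrable M (\<lambda>x. f x * g x)"
proof (rule Bochner_Integration.integrable_bound)
  show "integrable M (\<lambda>x. (f x)\<^sup>2 + (g x)\<^sup>2)"
    using assms by (simp add: square_integrable_def)
  show "(\<lambda>x. f x * g x) \<in> borel_measurable M"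
    using assms by (auto simp: square_integrable_def)
  show "AE x in M. norm (f x * g x) \<le> norm ((f x)\<^sup>2 + (g x)\<^sup>2)"
    by (intro always_eventually allI) (simp add: abs_mult_le_sum_squares)
qed

lemma square_integrable_cmult:
  "square_integrable M f \<Longrightarrow> square_integrable M (\<lambda>x. c * f x)"
  by (auto simp: square_integrable_def power_mult_distrib)

lemma square_integrable_add:
  assumes "square_integrable M f" "square_integrable M g"
  shows "square_integrable M (\<lambda>x. f x + g x)"
  using assms square_integrable_mult[OF assms]
  by (auto simp: square_integrable_def power2_sum mult.assoc)

lemma square_integrable_diff:
  assumes "square_integrable M f" "square_integrable M g"
  shows "square_integrable M (\<lambda>x. f x - g x)"
  using square_integrable_add[OF assms(1) square_integrable_cmult[OF assms(2), of "-1"]] by simp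

lemma square_integrable_sum:
  assumes "\<And>i. i \<in> I \<Longrightarrow> square_integrable M (f i)"
  shows "square_integrable M (\<lambda>x. \<Sum>i\<in>I. f i x)"
  using assms
  by (induction I rule: infinite_finite_induct)
     (auto intro: square_integrable_add simp: square_integrable_def[of M "\<lambda>_. 0"])

lemma (in prob_space) square_integrable_const: "square_integrable M (\<lambda>_. c)"
  by (simp add: square_integrable_def)

lemma (in prob_space) integrable_if_square_integrable:
  "square_integrable M f \<Longrightarrow> integrable M f"
  using square_integrable_mult[OF _ square_integrable_const[of 1]] by simp

text \<open>
  The usual discriminant argument: the integral of \<open>(f - s g)\<^sup>2\<close> is a quadratic in \<open>s\<close> without
  negative values.
\<close>

lemma Cauchy_Schwarz_integral:
  assumes f: "square_integrable M f" and g: "square_integrable M g"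
  shows "(\<integral>x. f x * g x \<partial>M)\<^sup>2 \<le> (\<integral>x. (f x)\<^sup>2 \<partial>M) * (\<integral>x. (g x)\<^sup>2 \<partial>M)"
proof -
  define A B C where "A = (\<integral>x. (f x)\<^sup>2 \<partial>M)" and "B = (\<integral>x. f x * g x \<partial>M)"
    and "C = (\<integral>x. (g x)\<^sup>2 \<partial>M)"
  have int: "integrable M (\<lambda>x. (f x)\<^sup>2)" "integrable M (\<lambda>x. (g x)\<^sup>2)"
    "integrable M (\<lambda>x. f x * g x)"
    using f g square_integrable_mult[OF f g] by (auto simp: square_integrable_def)
  have quad: "0 \<le> A - 2 * s * B + s\<^sup>2 * C" for s
  proof -
    have "0 \<le> (\<integral>x. (f x - s * g x)\<^sup>2 \<partial>M)" by simp
    also have "(\<lambda>x. (f x - s * g x)\<^sup>2) = (\<lambda>x. (f x)\<^sup>2 - 2 * s * (f x * g x) + s\<^sup>2 * (g x)\<^sup>2)"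
      by (auto simp: power2_eq_square algebra_simps)
    also have "(\<integral>x. (f x)\<^sup>2 - 2 * s * (f x * g x) + s\<^sup>2 * (g x)\<^sup>2 \<partial>M) = A - 2 * s * B + s\<^sup>2 * C"
      using int by (simp add: A_def B_def C_def)
    finally show ?thesis .
  qed
  have "B\<^sup>2 \<le> A * C"
  proof (cases "C = 0")
    case True
    have "B = 0"
    proof (rule ccontr)
      assume "B \<noteq> 0"
      then show False
        \<comment> \<open>this \<open>s\<close> makes the linear function \<open>A - 2 s B\<close> equal to \<open>-1\<close>\<close>
        using quad[of "(A + 1) / (2 * B)"] True by simp
    qed
    with True show ?thesis by simp
  next
    case False
    moreover have "C \<ge> 0" by (simp add: C_def)
    ultimately have "C > 0" by simp
    then show ?thesis
      \<comment> \<open>the minimiser of the quadratic\<close>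
      using quad[of "B / C"] by (simp add: field_simps power2_eq_square)
  qed
  then show ?thesis by (simp add: A_def B_def C_def)
qed

lemma tendsto_integral_mult_zero:
  assumes f: "\<And>k. square_integrable M (f k)" and g: "\<And>k. square_integrable M (g k)"
    and lim: "(\<lambda>k. \<integral>x. (f k x)\<^sup>2 \<partial>M) \<longlonglongrightarrow> 0" "(\<lambda>k. \<integral>x. (g k x)\<^sup>2 \<partial>M) \<longlonglongrightarrow> L"
  shows "(\<lambda>k. \<integral>x. f k x * g k x \<partial>M) \<longlonglongrightarrow> 0"
proof -
  have "(\<lambda>k. (\<integral>x. (f k x)\<^sup>2 \<partial>M) * (\<integral>x. (g k x)\<^sup>2 \<partial>M)) \<longlonglongrightarrow> 0"
    using tendsto_mult[OF lim] by simp
  then have "(\<lambda>k. (\<integral>x. f k x * g k x \<partial>M)\<^sup>2) \<longlonglongrightarrow> 0"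
    by (rule tendsto_sandwich[OF _ _ tendsto_const, rotated 2])
       (auto intro!: always_eventually Cauchy_Schwarz_integral f g)
  from tendsto_real_sqrt[OF this] show ?thesis
    by (simp add: tendsto_rabs_zero_iff)
qed

text \<open>
  Continuity of the inner product of \<open>L\<^sup>2\<close>: with \<open>f\<^sub>k = F + p\<close> and \<open>g\<^sub>k = G + q\<close> the three terms
  of the product that contain \<open>p\<close> or \<open>q\<close> vanish in the limit by the Cauchy-Schwarz inequality.
\<close>

lemma tendsto_integral_mult:
  assumes f: "\<And>k. square_integrable M (f k)" "square_integrable M F"
    and g: "\<And>k. square_integrable M (g k)" "square_integrable M G"
    and limf: "(\<lambda>k. \<integral>x. (f k x - F x)\<^sup>2 \<partial>M) \<longlonglongrightarrow> 0"
    and limg: "(\<lambda>k. \<integral>x. (g k x - G x)\<^sup>2 \<partial>M) \<longlonglongrightarrow> 0"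
  shows "(\<lambda>k. \<integral>x. f k x * g k x \<partial>M) \<longlonglongrightarrow> (\<integral>x. F x * G x \<partial>M)"
proof -
  note sq = f g square_integrable_diff[OF f] square_integrable_diff[OF g]
  have 1: "(\<lambda>k. \<integral>x. (f k x - F x) * G x \<partial>M) \<longlonglongrightarrow> 0"
    by (rule tendsto_integral_mult_zero[OF _ _ limf tendsto_const]) (auto intro: sq)
  have 2: "(\<lambda>k. \<integral>x. (g k x - G x) * F x \<partial>M) \<longlonglongrightarrow> 0"
    by (rule tendsto_integral_mult_zero[OF _ _ limg tendsto_const]) (auto intro: sq)
  have 3: "(\<lambda>k. \<integral>x. (f k x - F x) * (g k x - G x) \<partial>M) \<longlonglongrightarrow> 0"
    by (rule tendsto_integral_mult_zero[OF _ _ limf limg]) (auto intro: sq)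
  have "(\<integral>x. f k x * g k x \<partial>M) = (\<integral>x. (f k x - F x) * G x \<partial>M) + (\<integral>x. (g k x - G x) * F x \<partial>M)
      + (\<integral>x. (f k x - F x) * (g k x - G x) \<partial>M) + (\<integral>x. F x * G x \<partial>M)" for k
  proof -
    have "(\<integral>x. f k x * g k x \<partial>M) = (\<integral>x. (f k x - F x) * G x + (g k x - G x) * F x
      + (f k x - F x) * (g k x - G x) + F x * G x \<partial>M)"
      by (simp add: algebra_simps)
    also have "\<dots> = (\<integral>x. (f k x - F x) * G x \<partial>M) + (\<integral>x. (g k x - G x) * F x \<partial>M)
      + (\<integral>x. (f k x - F x) * (g k x - G x) \<partial>M) + (\<integral>x. F x * G x \<partial>M)"
      by (subst Bochner_Integration.integral_add;
          (intro Bochner_Integration.integrable_add square_integrable_mult sq)?)+ simp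
    finally show ?thesis .
  qed
  then show ?thesis
    using tendsto_add[OF tendsto_add[OF tendsto_add[OF 1 2] 3] tendsto_const, of "\<integral>x. F x * G x \<partial>M"]
    by simp
qed

section \<open>The isometry of the Wiener integral\<close>

lemma square_integrable_step_function: "square_integrable lborel (step_function n t c)"
proof -
  have "square_integrable lborel (\<lambda>x. indicator {a<..b} x)" for a b :: real
  proof -
    have "(\<lambda>x. (indicator {a<..b} x :: real)\<^sup>2) = indicator {a<..b}"
      by (auto simp: indicator_def)
    then show ?thesis
      by (cases "a \<le> b") (auto simp: square_integrable_def)
  qed
  then show ?thesis
    unfolding step_function_def[abs_def]
    by (intro square_integrable_sum square_integrable_cmult)
qed

text \<open>
  The length of an overlap of two intervals, in the form in which polarisation produces it in
  \<open>expectation_increment_mult\<close>.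
\<close>

lemma measure_Ioc_Int_Ioc:
  fixes a b c d :: real
  assumes "a \<le> b" "c \<le> d"
  shows "measure lborel ({a<..b} \<inter> {c<..d})
    = (\<bar>a - d\<bar> + \<bar>b - c\<bar> - \<bar>a - c\<bar> - \<bar>b - d\<bar>) / 2"
proof -
  have "{a<..b} \<inter> {c<..d} = {max a c<..min b d}" by auto
  then show ?thesis
    using assms by (cases "max a c \<le> min b d") auto
qed

context bilateral_wiener_process
begin

lemma increment_moments:
  shows square_integrable_increment: "square_integrable M (\<lambda>\<omega>. W b \<omega> - W a \<omega>)"
    and expectation_increment: "expectation (\<lambda>\<omega>. W b \<omega> - W a \<omega>) = 0"
    and expectation_increment_square: "expectation (\<lambda>\<omega>. (W b \<omega> - W a \<omega>)\<^sup>2) = \<bar>b - a\<bar>"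
proof -
  note [measurable] = W_measurable
  have *: "integrable M (\<lambda>\<omega>. (W t \<omega> - W s \<omega>)\<^sup>2) \<and> expectation (\<lambda>\<omega>. W t \<omega> - W s \<omega>) = 0
      \<and> expectation (\<lambda>\<omega>. (W t \<omega> - W s \<omega>)\<^sup>2) = t - s" if "s < t" for s t
  proof -
    note D = W_normal_increments[OF that]
    have pos: "sqrt (t - s) > 0" using that by simp
    have E: "expectation (\<lambda>\<omega>. W t \<omega> - W s \<omega>) = 0"
      by (rule normal_distributed_expectation[OF pos D])
    moreover have "expectation (\<lambda>\<omega>. (W t \<omega> - W s \<omega>)\<^sup>2) = t - s"
      using normal_distributed_variance[OF pos D] E that by simp
    moreover have "integrable M (\<lambda>\<omega>. (W t \<omega> - W s \<omega>)\<^sup>2)"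
      using integrable_normal_moment[OF pos, of 0 2]
      by (subst distributed_integrable[OF D, symmetric]) auto
    ultimately show ?thesis by simp
  qed
  have sym: "(\<lambda>\<omega>. (W b \<omega> - W a \<omega>)\<^sup>2) = (\<lambda>\<omega>. (W a \<omega> - W b \<omega>)\<^sup>2)"
    by (simp add: power2_commute)
  have neg: "expectation (\<lambda>\<omega>. W b \<omega> - W a \<omega>) = - expectation (\<lambda>\<omega>. W a \<omega> - W b \<omega>)"
    by (subst Bochner_Integration.integral_minus[symmetric]) simp
  consider "a < b" | "a = b" | "b < a" by linarith
  note cases = this
  from cases show "square_integrable M (\<lambda>\<omega>. W b \<omega> - W a \<omega>)"
    by cases (use *[of a b] *[of b a] sym in \<open>auto simp: square_integrable_def\<close>)
  from cases show "expectation (\<lambda>\<omega>. W b \<omega> - W a \<omega>) = 0"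
    by cases (use *[of a b] *[of b a] neg in auto)
  from cases show "expectation (\<lambda>\<omega>. (W b \<omega> - W a \<omega>)\<^sup>2) = \<bar>b - a\<bar>"
    by cases (use *[of a b] *[of b a] sym in auto)
qed

text \<open>
  Covariances of increments over arbitrary, possibly overlapping intervals come from variances of
  increments alone: \<open>2 (B - A) (D - C) = (A - D)\<^sup>2 + (B - C)\<^sup>2 - (A - C)\<^sup>2 - (B - D)\<^sup>2\<close>. This avoids
  the common refinement of two partitions.
\<close>

lemma expectation_increment_mult:
  assumes "a \<le> b" "c \<le> d"
  shows "expectation (\<lambda>\<omega>. (W b \<omega> - W a \<omega>) * (W d \<omega> - W c \<omega>)) = measure lborel ({a<..b} \<inter> {c<..d})"
proof -
  have int: "integrable M (\<lambda>\<omega>. (W t \<omega> - W s \<omega>)\<^sup>2)" for s t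
    using square_integrable_increment by (simp add: square_integrable_def)
  have "(\<lambda>\<omega>. (W b \<omega> - W a \<omega>) * (W d \<omega> - W c \<omega>)) = (\<lambda>\<omega>. ((W a \<omega> - W d \<omega>)\<^sup>2 + (W b \<omega> - W c \<omega>)\<^sup>2
      - (W a \<omega> - W c \<omega>)\<^sup>2 - (W b \<omega> - W d \<omega>)\<^sup>2) / 2)"
    by (auto simp: power2_eq_square algebra_simps)
  then have "expectation (\<lambda>\<omega>. (W b \<omega> - W a \<omega>) * (W d \<omega> - W c \<omega>))
      = (\<bar>a - d\<bar> + \<bar>b - c\<bar> - \<bar>a - c\<bar> - \<bar>b - d\<bar>) / 2"
    by (simp add: int expectation_increment_square)
  with measure_Ioc_Int_Ioc[OF assms] show ?thesis by simp
qed

lemma square_integrable_step_wiener_integral: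
  "square_integrable M (step_wiener_integral W n t c)"
  unfolding step_wiener_integral_def[abs_def]
  by (intro square_integrable_sum square_integrable_cmult square_integrable_increment)

lemma expectation_step_wiener_integral: "expectation (step_wiener_integral W n t c) = 0"
  unfolding step_wiener_integral_def[abs_def]
  by (subst Bochner_Integration.integral_sum)
     (auto simp: expectation_increment
           intro!: integrable_mult_right
             integrable_if_square_integrable[OF square_integrable_increment])

lemma step_wiener_isometry:
  assumes "mono t" "mono s"
  shows "expectation (\<lambda>\<omega>. step_wiener_integral W n t c \<omega> * step_wiener_integral W k s d \<omega>)
    = (\<integral>x. step_function n t c x * step_function k s d x \<partial>lborel)"
proof -
  have int: "integrable M (\<lambda>\<omega>. (W b \<omega> - W a \<omega>) * (W b' \<omega> - W a' \<omega>))" for a b a' b'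
    by (intro square_integrable_mult square_integrable_increment)
  have ind: "indicator {a<..b} x * indicator {a'<..b'} x = (indicator ({a<..b} \<inter> {a'<..b'}) x :: real)"
    for a b a' b' x :: real
    by (simp add: indicator_inter_arith del: Int_greaterThanAtMost)
  have fin: "emeasure lborel ({a<..b} \<inter> {a'<..b'}) < \<infinity>" for a b a' b' :: real
  proof -
    have "{a<..b} \<inter> {a'<..b'} = {max a a'<..min b b'}" by auto
    then show ?thesis by (cases "max a a' \<le> min b b'") auto
  qed
  have "expectation (\<lambda>\<omega>. step_wiener_integral W n t c \<omega> * step_wiener_integral W k s d \<omega>)
     = expectation (\<lambda>\<omega>. \<Sum>i<n. \<Sum>j<k. (c i * d j) *
         ((W (t (Suc i)) \<omega> - W (t i) \<omega>) * (W (s (Suc j)) \<omega> - W (s j) \<omega>)))"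
    unfolding step_wiener_integral_def sum_product by (simp add: mult_ac)
  also have "\<dots> = (\<Sum>i<n. \<Sum>j<k. (c i * d j) * measure lborel ({t i<..t (Suc i)} \<inter> {s j<..s (Suc j)}))"
    using assms
    by (simp add: Bochner_Integration.integral_sum int expectation_increment_mult monoD)
  also have "\<dots> = (\<integral>x. (\<Sum>i<n. \<Sum>j<k. (c i * d j) *
         indicator ({t i<..t (Suc i)} \<inter> {s j<..s (Suc j)}) x) \<partial>lborel)"
    by (intro has_bochner_integral_integral_eq[symmetric] has_bochner_integral_sum
        has_bochner_integral_mult_right has_bochner_integral_real_indicator fin) auto
  also have "\<dots> = (\<integral>x. step_function n t c x * step_function k s d x \<partial>lborel)"
    unfolding step_function_def sum_product ind[symmetric] by (simp add: mult_ac)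
  finally show ?thesis .
qed

lemma has_wiener_integralE:
  assumes "has_wiener_integral M W f J"
  obtains t n c where "\<And>k. mono (t k)"
    and "(\<lambda>k. \<integral>x. (step_function (n k) (t k) (c k) x - f x)\<^sup>2 \<partial>lborel) \<longlonglongrightarrow> 0"
    and "(\<lambda>k. \<integral>\<omega>. (step_wiener_integral W (n k) (t k) (c k) \<omega> - J \<omega>)\<^sup>2 \<partial>M) \<longlonglongrightarrow> 0"
proof -
  \<comment> \<open>\<open>P\<close> keeps the classical reasoner from unifying with the higher-order variables \<open>n\<close>, \<open>t\<close>, \<open>c\<close>\<close>
  define P where "P n t c \<longleftrightarrow> (\<forall>k. mono (t k)) \<and>
      (\<lambda>k. \<integral>x. (step_function (n k) (t k) (c k) x - f x)\<^sup>2 \<partial>lborel) \<longlonglongrightarrow> 0 \<and>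
      (\<lambda>k. \<integral>\<omega>. (step_wiener_integral W (n k) (t k) (c k) \<omega> - J \<omega>)\<^sup>2 \<partial>M) \<longlonglongrightarrow> 0" for n t c
  have "\<exists>n t c. P n t c"
    using assms by (simp add: has_wiener_integral_def P_def)
  then obtain n t c where "P n t c" by blast
  then show thesis
    by (intro that[of t n c]) (simp_all add: P_def)
qed

text \<open>
  Both sides are limits of the corresponding expressions for step functions, where they agree.
\<close>

lemma wiener_isometry:
  assumes "has_wiener_integral M W f J" "has_wiener_integral M W g K"
  shows "expectation (\<lambda>\<omega>. J \<omega> * K \<omega>) = (\<integral>x. f x * g x \<partial>lborel)"
proof -
  obtain t n c where mono: "\<And>k. mono (t k)"
    and lim: "(\<lambda>k. \<integral>x. (step_function (n k) (t k) (c k) x - f x)\<^sup>2 \<partial>lborel) \<longlonglongrightarrow> 0"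
      "(\<lambda>k. \<integral>\<omega>. (step_wiener_integral W (n k) (t k) (c k) \<omega> - J \<omega>)\<^sup>2 \<partial>M) \<longlonglongrightarrow> 0"
    by (rule has_wiener_integralE[OF assms(1)]) (rule that)
  obtain t' n' c' where mono': "\<And>k. mono (t' k)"
    and lim': "(\<lambda>k. \<integral>x. (step_function (n' k) (t' k) (c' k) x - g x)\<^sup>2 \<partial>lborel) \<longlonglongrightarrow> 0"
      "(\<lambda>k. \<integral>\<omega>. (step_wiener_integral W (n' k) (t' k) (c' k) \<omega> - K \<omega>)\<^sup>2 \<partial>M) \<longlonglongrightarrow> 0"
    by (rule has_wiener_integralE[OF assms(2)]) (rule that)
  have sq: "square_integrable lborel f" "square_integrable lborel g"
      "square_integrable M J" "square_integrable M K"
    using assms by (auto simp: has_wiener_integral_def square_integrable_def)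
  have "(\<lambda>k. expectation (\<lambda>\<omega>. step_wiener_integral W (n k) (t k) (c k) \<omega>
      * step_wiener_integral W (n' k) (t' k) (c' k) \<omega>)) \<longlonglongrightarrow> expectation (\<lambda>\<omega>. J \<omega> * K \<omega>)"
    by (intro tendsto_integral_mult square_integrable_step_wiener_integral sq lim lim')
  moreover have "(\<lambda>k. \<integral>x. step_function (n k) (t k) (c k) x * step_function (n' k) (t' k) (c' k) x \<partial>lborel)
      \<longlonglongrightarrow> (\<integral>x. f x * g x \<partial>lborel)"
    by (intro tendsto_integral_mult square_integrable_step_function sq lim lim')
  ultimately show ?thesis
    using mono mono' by (simp add: step_wiener_isometry LIMSEQ_unique)
qed

lemma expectation_wiener_integral:
  assumes "has_wiener_integral M W f J"
  shows "expectation J = 0"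
proof -
  obtain t n c where
    lim: "(\<lambda>k. \<integral>\<omega>. (step_wiener_integral W (n k) (t k) (c k) \<omega> - J \<omega>)\<^sup>2 \<partial>M) \<longlonglongrightarrow> 0"
    by (rule has_wiener_integralE[OF assms]) (rule that)
  have "square_integrable M J"
    using assms by (auto simp: has_wiener_integral_def square_integrable_def)
  then have "(\<lambda>k. expectation (\<lambda>\<omega>. step_wiener_integral W (n k) (t k) (c k) \<omega> * 1))
      \<longlonglongrightarrow> expectation (\<lambda>\<omega>. J \<omega> * 1)"
    by (intro tendsto_integral_mult[OF _ _ _ _ lim] square_integrable_step_wiener_integral
        square_integrable_const) auto
  then show ?thesis
    by (simp add: expectation_step_wiener_integral LIMSEQ_const_iff)
qed

end

section \<open>Time integrals of processes with continuous paths\<close>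

lemma floor_grid_tendsto: "(\<lambda>n. real_of_int \<lfloor>t * real (Suc n)\<rfloor> / real (Suc n)) \<longlonglongrightarrow> t"
proof (rule tendsto_sandwich[OF _ _ _ tendsto_const])
  have 1: "t - 1 / real (Suc n) \<le> real_of_int \<lfloor>t * real (Suc n)\<rfloor> / real (Suc n)" for n
  proof -
    have "t * real (Suc n) - 1 \<le> real_of_int \<lfloor>t * real (Suc n)\<rfloor>" by linarith
    then have "(t * real (Suc n) - 1) / real (Suc n) \<le> real_of_int \<lfloor>t * real (Suc n)\<rfloor> / real (Suc n)"
      by (rule divide_right_mono) simp
    then show ?thesis by (simp add: diff_divide_distrib del: of_nat_Suc)
  qed
  then show "\<forall>\<^sub>F n in sequentially. t - 1 / real (Suc n) \<le> real_of_int \<lfloor>t * real (Suc n)\<rfloor> / real (Suc n)"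
    by (rule always_eventually[OF allI])
  have 2: "real_of_int \<lfloor>t * real (Suc n)\<rfloor> / real (Suc n) \<le> t" for n
  proof -
    have "real_of_int \<lfloor>t * real (Suc n)\<rfloor> / real (Suc n) \<le> t * real (Suc n) / real (Suc n)"
      by (rule divide_right_mono) auto
    then show ?thesis by (simp del: of_nat_Suc)
  qed
  then show "\<forall>\<^sub>F n in sequentially. real_of_int \<lfloor>t * real (Suc n)\<rfloor> / real (Suc n) \<le> t"
    by (rule always_eventually[OF allI])
  show "(\<lambda>n. t - 1 / real (Suc n)) \<longlonglongrightarrow> t"
    using tendsto_diff[OF tendsto_const LIMSEQ_inverse_real_of_nat, of t] by (simp add: inverse_eq_divide)
qed

text \<open>
  A process with continuous paths is the pointwise limit of its discretisations
  \<open>(t, \<omega>) \<mapsto> Y (\<lfloor>t n\<rfloor> / n) \<omega>\<close>. Each of these takes its time argument from a countable set and is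
  therefore jointly measurable.
\<close>

lemma continuous_process_measurable:
  fixes Y :: "real \<Rightarrow> 'a \<Rightarrow> real"
  assumes meas: "\<And>t. Y t \<in> borel_measurable M"
    and cont: "\<And>\<omega>. \<omega> \<in> space M \<Longrightarrow> continuous_on UNIV (\<lambda>t. Y t \<omega>)"
  shows "(\<lambda>(t, \<omega>). Y t \<omega>) \<in> borel_measurable (lborel \<Otimes>\<^sub>M M)"
proof (rule borel_measurable_LIMSEQ_real)
  fix p :: "real \<times> 'a"
  assume "p \<in> space (lborel \<Otimes>\<^sub>M M)"
  then have "isCont (\<lambda>t. Y t (snd p)) (fst p)"
    using cont[of "snd p"] by (auto simp: space_pair_measure continuous_on_eq_continuous_at)
  from isCont_tendsto_compose[OF this floor_grid_tendsto]
  show "(\<lambda>n. Y (real_of_int \<lfloor>fst p * real (Suc n)\<rfloor> / real (Suc n)) (snd p))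
      \<longlonglongrightarrow> (case p of (t, \<omega>) \<Rightarrow> Y t \<omega>)"
    by (simp add: case_prod_beta)
next
  fix n
  show "(\<lambda>p. Y (real_of_int \<lfloor>fst p * real (Suc n)\<rfloor> / real (Suc n)) (snd p))
      \<in> borel_measurable (lborel \<Otimes>\<^sub>M M)"
  proof (rule measurable_compose_countable[where g="\<lambda>p. \<lfloor>fst p * real (Suc n)\<rfloor>"
        and f="\<lambda>i p. Y (real_of_int i / real (Suc n)) (snd p)"])
    show "(\<lambda>p. Y (real_of_int i / real (Suc n)) (snd p)) \<in> borel_measurable (lborel \<Otimes>\<^sub>M M)" for i
      by (rule measurable_compose[OF measurable_snd meas])
    show "(\<lambda>p. \<lfloor>fst p * real (Suc n)\<rfloor>) \<in> measurable (lborel \<Otimes>\<^sub>M M) (count_space UNIV)"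
      by measurable
  qed
qed

context prob_space
begin

text \<open>
  The hypothesis of Fubini's theorem for the two results that follow. Bounded second moments bound
  the expectation of \<open>\<bar>Z\<^sub>t Y\<^sub>t\<bar>\<close> uniformly in \<open>t\<close>, and the time interval has finite length.
\<close>

lemma integrable_process_mult:
  fixes Y :: "real \<Rightarrow> 'a \<Rightarrow> real"
  assumes joint[measurable]: "(\<lambda>(t, \<omega>). Y t \<omega>) \<in> borel_measurable (lborel \<Otimes>\<^sub>M M)"
    and jointZ[measurable]: "(\<lambda>(t, \<omega>). Z t \<omega>) \<in> borel_measurable (lborel \<Otimes>\<^sub>M M)"
    and Y: "\<And>t. square_integrable M (Y t)" and Z: "\<And>t. square_integrable M (Z t)"
    and bound: "\<And>t. expectation (\<lambda>\<omega>. (Y t \<omega>)\<^sup>2) \<le> K" "\<And>t. expectation (\<lambda>\<omega>. (Z t \<omega>)\<^sup>2) \<le> L"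
  shows "integrable (lborel \<Otimes>\<^sub>M M) (\<lambda>(t, \<omega>). indicator {a..b} t * (Z t \<omega> * Y t \<omega>))"
proof -
  interpret pair_sigma_finite lborel M ..
  have bd: "expectation (\<lambda>\<omega>. \<bar>Z t \<omega> * Y t \<omega>\<bar>) \<le> L + K" for t
  proof -
    have "expectation (\<lambda>\<omega>. \<bar>Z t \<omega> * Y t \<omega>\<bar>) \<le> expectation (\<lambda>\<omega>. (Z t \<omega>)\<^sup>2 + (Y t \<omega>)\<^sup>2)"
      using Y[of t] Z[of t] square_integrable_mult[OF Z Y, of t t]
      by (intro integral_mono abs_mult_le_sum_squares) (auto simp: square_integrable_def)
    also have "\<dots> = expectation (\<lambda>\<omega>. (Z t \<omega>)\<^sup>2) + expectation (\<lambda>\<omega>. (Y t \<omega>)\<^sup>2)"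
      using Y[of t] Z[of t] by (simp add: square_integrable_def)
    finally show ?thesis using bound[of t] by linarith
  qed
  show ?thesis
  proof (rule Fubini_integrable)
    show "(\<lambda>(t, \<omega>). indicator {a..b} t * (Z t \<omega> * Y t \<omega>)) \<in> borel_measurable (lborel \<Otimes>\<^sub>M M)"
      by measurable
    have "integrable lborel (\<lambda>t. indicator {a..b} t * expectation (\<lambda>\<omega>. \<bar>Z t \<omega> * Y t \<omega>\<bar>))"
    proof (rule Bochner_Integration.integrable_bound)
      show "integrable lborel (\<lambda>t. (L + K) * indicator {a..b} t :: real)"
        by (cases "a \<le> b") auto
      show "(\<lambda>t. indicator {a..b} t * expectation (\<lambda>\<omega>. \<bar>Z t \<omega> * Y t \<omega>\<bar>)) \<in> borel_measurable lborel"
        by measurable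
      have "norm (indicator {a..b} t * expectation (\<lambda>\<omega>. \<bar>Z t \<omega> * Y t \<omega>\<bar>))
        \<le> norm ((L + K) * indicator {a..b} t)" for t
      proof -
        have "0 \<le> expectation (\<lambda>\<omega>. \<bar>Z t \<omega> * Y t \<omega>\<bar>)" by simp
        with bd[of t] show ?thesis by (cases "t \<in> {a..b}") (auto simp del: abs_mult)
      qed
      then show "AE t in lborel. norm (indicator {a..b} t * expectation (\<lambda>\<omega>. \<bar>Z t \<omega> * Y t \<omega>\<bar>))
        \<le> norm ((L + K) * indicator {a..b} t)"
        by (intro always_eventually allI)
    qed
    then show "integrable lborel (\<lambda>t. expectation (\<lambda>\<omega>. norm
        (case (t, \<omega>) of (t, \<omega>) \<Rightarrow> indicator {a..b} t * (Z t \<omega> * Y t \<omega>))))"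
      by (simp add: abs_mult)
    show "AE t in lborel. integrable M (\<lambda>\<omega>. case (t, \<omega>) of (t, \<omega>) \<Rightarrow> indicator {a..b} t * (Z t \<omega> * Y t \<omega>))"
      by (intro always_eventually allI) (simp add: square_integrable_mult[OF Z Y])
  qed
qed

lemma expectation_mult_time_integral:
  fixes Y :: "real \<Rightarrow> 'a \<Rightarrow> real"
  assumes joint: "(\<lambda>(t, \<omega>). Y t \<omega>) \<in> borel_measurable (lborel \<Otimes>\<^sub>M M)"
    and Y: "\<And>t. square_integrable M (Y t)" "\<And>t. expectation (\<lambda>\<omega>. (Y t \<omega>)\<^sup>2) \<le> K"
    and Z: "square_integrable M Z"
  shows "expectation (\<lambda>\<omega>. Z \<omega> * (LBINT t:{a..b}. Y t \<omega>)) = (LBINT t:{a..b}. expectation (\<lambda>\<omega>. Z \<omega> * Y t \<omega>))"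
proof -
  interpret pair_sigma_finite lborel M ..
  have [measurable]: "Z \<in> borel_measurable M"
    using Z by (rule square_integrable_measurable)
  have "integrable (lborel \<Otimes>\<^sub>M M) (\<lambda>(t, \<omega>). indicator {a..b} t * (Z \<omega> * Y t \<omega>))"
    by (rule integrable_process_mult[OF joint _ Y(1) Z Y(2) order_refl]) measurable
  from Fubini_integral[OF this]
  have "expectation (\<lambda>\<omega>. \<integral>t. indicator {a..b} t * (Z \<omega> * Y t \<omega>) \<partial>lborel)
      = (\<integral>t. expectation (\<lambda>\<omega>. indicator {a..b} t * (Z \<omega> * Y t \<omega>)) \<partial>lborel)" .
  moreover have "(\<integral>t. indicator {a..b} t * (Z \<omega> * Y t \<omega>) \<partial>lborel) = Z \<omega> * (LBINT t:{a..b}. Y t \<omega>)" for \<omega>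
    unfolding mult.left_commute[of _ "Z \<omega>"] by (simp add: set_lebesgue_integral_def)
  ultimately show ?thesis
    by (simp add: set_lebesgue_integral_def)
qed

text \<open>
  By the Cauchy-Schwarz inequality in \<open>t\<close>, the square of the time integral is at most
  \<open>(b - a) \<integral>\<^sub>a\<^sup>b Y\<^sub>t\<^sup>2 dt\<close>, whose expectation is finite by Fubini's theorem.
\<close>

lemma square_integrable_time_integral:
  fixes Y :: "real \<Rightarrow> 'a \<Rightarrow> real"
  assumes meas: "\<And>t. square_integrable M (Y t)"
    and cont: "\<And>\<omega>. \<omega> \<in> space M \<Longrightarrow> continuous_on UNIV (\<lambda>t. Y t \<omega>)"
    and bound: "\<And>t. expectation (\<lambda>\<omega>. (Y t \<omega>)\<^sup>2) \<le> K"
  shows "square_integrable M (\<lambda>\<omega>. LBINT t:{a..b}. Y t \<omega>)"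
proof -
  interpret pair_sigma_finite lborel M ..
  have joint[measurable]: "(\<lambda>(t, \<omega>). Y t \<omega>) \<in> borel_measurable (lborel \<Otimes>\<^sub>M M)"
    by (intro continuous_process_measurable square_integrable_measurable meas cont)
  have [measurable]: "(\<lambda>\<omega>. LBINT t:{a..b}. Y t \<omega>) \<in> borel_measurable M"
    unfolding set_lebesgue_integral_def by measurable
  have "integrable (lborel \<Otimes>\<^sub>M M) (\<lambda>(t, \<omega>). indicator {a..b} t * (Y t \<omega> * Y t \<omega>))"
    by (rule integrable_process_mult[OF joint joint meas meas bound bound])
  then have int: "integrable M (\<lambda>\<omega>. (\<integral>t. indicator {a..b} t * (Y t \<omega> * Y t \<omega>) \<partial>lborel))"
    by (rule integrable_snd)
  have le: "(LBINT t:{a..b}. Y t \<omega>)\<^sup>2 \<le> measure lborel {a..b} * (\<integral>t. indicator {a..b} t * (Y t \<omega> * Y t \<omega>) \<partial>lborel)"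
    if "\<omega> \<in> space M" for \<omega>
  proof -
    have c: "continuous_on {a..b} (\<lambda>t. Y t \<omega>)"
      using cont[OF that] continuous_on_subset by blast
    have ind: "(indicator {a..b} t :: real)\<^sup>2 = indicator {a..b} t" for t
      by (auto simp: indicator_def)
    have "square_integrable lborel (indicator {a..b} :: real \<Rightarrow> real)"
      by (cases "a \<le> b") (auto simp: square_integrable_def ind)
    moreover have "square_integrable lborel (\<lambda>t. indicator {a..b} t * Y t \<omega>)"
      using borel_integrable_atLeastAtMost'[OF c]
        borel_integrable_atLeastAtMost'[OF continuous_on_power[OF c, of 2]]
      by (auto simp: square_integrable_def set_integrable_def power_mult_distrib ind)
    ultimately have "(\<integral>t. indicator {a..b} t * (indicator {a..b} t * Y t \<omega>) \<partial>lborel)\<^sup>2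
      \<le> (\<integral>t. (indicator {a..b} t :: real)\<^sup>2 \<partial>lborel) * (\<integral>t. (indicator {a..b} t * Y t \<omega>)\<^sup>2 \<partial>lborel)"
      by (rule Cauchy_Schwarz_integral)
    then show ?thesis
      by (simp add: set_lebesgue_integral_def mult.assoc[symmetric] power2_eq_square[symmetric] ind
          power_mult_distrib flip: power2_eq_square)
  qed
  have "integrable M (\<lambda>\<omega>. (LBINT t:{a..b}. Y t \<omega>)\<^sup>2)"
  proof (rule Bochner_Integration.integrable_bound)
    show "integrable M (\<lambda>\<omega>. measure lborel {a..b} * (\<integral>t. indicator {a..b} t * (Y t \<omega> * Y t \<omega>) \<partial>lborel))"
      using int by simp
    show "AE \<omega> in M. norm ((LBINT t:{a..b}. Y t \<omega>)\<^sup>2) \<le>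
        norm (measure lborel {a..b} * (\<integral>t. indicator {a..b} t * (Y t \<omega> * Y t \<omega>) \<partial>lborel))"
      using le by (intro AE_I2) (smt (verit) real_norm_def zero_le_power2)
  qed measurable
  then show ?thesis by (simp add: square_integrable_def)
qed

end

section \<open>Second moments of the stationary Ornstein-Uhlenbeck process\<close>

text \<open>
  With \<open>r = min s t\<close>, the product of the two kernels is
  \<open>exp (- \<theta> \<bar>s - t\<bar>) exp (- 2 \<theta> (r - x))\<close> on \<open>x \<le> r\<close> and zero elsewhere. The substitution
  \<open>y = 2 \<theta> (r - x)\<close> reduces its integral to that of \<open>exp (- y)\<close> over \<open>y \<ge> 0\<close>.
\<close>

lemma integral_OU_kernel_mult:
  fixes \<theta> s t :: real
  assumes "\<theta> > 0"
  shows "(\<integral>x. (indicator {..s} x * exp (- \<theta> * (s - x))) * (indicator {..t} x * exp (- \<theta> * (t - x))) \<partial>lborel)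
    = exp (- \<theta> * \<bar>s - t\<bar>) / (2 * \<theta>)"
proof -
  define r where "r = min s t"
  define g :: "real \<Rightarrow> real" where "g y = exp (- y) * indicator {0..} y" for y
  have "has_bochner_integral lborel g 1"
    using has_bochner_integral_I0i_power_exp_m'[of 0] by (simp add: g_def[abs_def])
  moreover have "- (2 * \<theta>) \<noteq> 0" using assms by simp
  ultimately have "has_bochner_integral lborel (\<lambda>x. g (2 * \<theta> * r + - (2 * \<theta>) * x))
      (1 /\<^sub>R \<bar>- (2 * \<theta>)\<bar>)"
    using lborel_has_bochner_integral_real_affine_iff[of "- (2 * \<theta>)" g 1 "2 * \<theta> * r"] by blast
  also have "1 /\<^sub>R \<bar>- (2 * \<theta>)\<bar> = 1 / (2 * \<theta>)"
    using assms by (simp add: abs_mult field_simps)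
  finally have "has_bochner_integral lborel (\<lambda>x. exp (- \<theta> * \<bar>s - t\<bar>) * g (2 * \<theta> * r + - (2 * \<theta>) * x))
      (exp (- \<theta> * \<bar>s - t\<bar>) * (1 / (2 * \<theta>)))"
    by (rule has_bochner_integral_mult_right)
  moreover have "exp (- \<theta> * \<bar>s - t\<bar>) * g (2 * \<theta> * r + - (2 * \<theta>) * x)
    = (indicator {..s} x * exp (- \<theta> * (s - x))) * (indicator {..t} x * exp (- \<theta> * (t - x)))" for x
  proof -
    have "0 \<le> 2 * \<theta> * r + - (2 * \<theta>) * x \<longleftrightarrow> 0 \<le> (2 * \<theta>) * (r - x)"
      by (simp add: algebra_simps)
    also have "\<dots> \<longleftrightarrow> x \<le> s \<and> x \<le> t"
      using assms by (auto simp: zero_le_mult_iff r_def)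
    finally have I: "indicator {0..} (2 * \<theta> * r + - (2 * \<theta>) * x) = (indicator {..s} x * indicator {..t} x :: real)"
      by (auto simp: indicator_def)
    have E: "exp (- \<theta> * \<bar>s - t\<bar>) * exp (- (2 * \<theta> * r + - (2 * \<theta>) * x))
        = exp (- \<theta> * (s - x)) * exp (- \<theta> * (t - x))"
      unfolding exp_add[symmetric] r_def by (rule arg_cong[where f=exp]) (auto simp: min_def abs_if algebra_simps)
    show ?thesis
      unfolding g_def mult.assoc[symmetric] E I by (simp only: mult_ac)
  qed
  ultimately show ?thesis
    by (simp add: has_bochner_integral_integral_eq)
qed

lemma integral_exp_abs_diff:
  fixes \<theta> S t :: real
  assumes "\<theta> > 0" "0 \<le> t" "t \<le> S"
  shows "(LBINT r:{0..S}. exp (- \<theta> * \<bar>r - t\<bar>)) = (2 - exp (- \<theta> * t) - exp (- \<theta> * (S - t))) / \<theta>"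
proof -
  let ?f = "\<lambda>r. exp (- \<theta> * \<bar>r - t\<bar>)"
  have "((\<lambda>r. exp (- \<theta> * (t - r))) has_integral (exp (- \<theta> * (t - t)) / \<theta> - exp (- \<theta> * (t - 0)) / \<theta>)) {0..t}"
    using assms
    by (intro fundamental_theorem_of_calculus)
       (auto intro!: derivative_eq_intros simp flip: has_real_derivative_iff_has_vector_derivative)
  then have 1: "(?f has_integral ((1 - exp (- \<theta> * t)) / \<theta>)) {0..t}"
    by (subst has_integral_cong[where g="\<lambda>r. exp (- \<theta> * (t - r))"]) (auto simp: diff_divide_distrib)
  have "((\<lambda>r. exp (- \<theta> * (r - t))) has_integral (- exp (- \<theta> * (S - t)) / \<theta> - (- exp (- \<theta> * (t - t)) / \<theta>))) {t..S}"
    using assms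
    by (intro fundamental_theorem_of_calculus)
       (auto intro!: derivative_eq_intros simp flip: has_real_derivative_iff_has_vector_derivative)
  then have 2: "(?f has_integral ((1 - exp (- \<theta> * (S - t))) / \<theta>)) {t..S}"
    by (subst has_integral_cong[where g="\<lambda>r. exp (- \<theta> * (r - t))"]) (auto simp: diff_divide_distrib)
  have "integral {0..S} ?f = (1 - exp (- \<theta> * t)) / \<theta> + (1 - exp (- \<theta> * (S - t))) / \<theta>"
    using has_integral_combine[OF assms(2,3) 1 2] by (rule integral_unique)
  moreover have "(LBINT r:{0..S}. ?f r) = integral {0..S} ?f"
    by (intro set_borel_integral_eq_integral(2) borel_integrable_atLeastAtMost' continuous_intros)
  ultimately show ?thesis by (simp add: add_divide_distrib[symmetric])
qed

context stationary_OU_process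
begin

definition centred :: "real \<Rightarrow> 'a \<Rightarrow> real" where
  "centred t \<omega> = X t \<omega> - m"

text \<open>
  Up to the factor \<open>\<theta>\<close> this is the score of the statistical model, that is, the derivative of the
  log-likelihood in \<open>m\<close>: it equals \<open>Z\<^sub>S - m (2 + \<theta> S)\<close> (see \<open>Z_stat_observation\<close>).
\<close>

definition score :: "real \<Rightarrow> 'a \<Rightarrow> real" where
  "score S \<omega> = Z_stat \<theta> S (\<lambda>t. centred t \<omega>)"

text \<open>
  The part of \<open>X\<^sub>S\<^sub>+\<^sub>h\<close> that the past of the process up to time \<open>S\<close> does not predict.
\<close>

definition innovation :: "real \<Rightarrow> real \<Rightarrow> 'a \<Rightarrow> real" where
  "innovation S h \<omega> = centred (S + h) \<omega> - exp (- \<theta> * h) * centred S \<omega>"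

lemma centred_wiener_integral:
  "has_wiener_integral M W (\<lambda>s. indicator {..t} s * exp (- \<theta> * (t - s))) (centred t)"
  using X_wiener_integral[of t] by (simp add: centred_def[abs_def])

lemma square_integrable_centred: "square_integrable M (centred t)"
  using centred_wiener_integral[of t] by (simp add: has_wiener_integral_def square_integrable_def)

lemma expectation_centred: "expectation (centred t) = 0"
  using centred_wiener_integral by (rule expectation_wiener_integral)

lemma continuous_on_centred:
  "\<omega> \<in> space M \<Longrightarrow> continuous_on UNIV (\<lambda>t. centred t \<omega>)"
  unfolding centred_def by (intro continuous_intros X_continuous)

lemma centred_measurable:
  "(\<lambda>(t, \<omega>). centred t \<omega>) \<in> borel_measurable (lborel \<Otimes>\<^sub>M M)"
  by (intro continuous_process_measurable square_integrable_measurable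
      square_integrable_centred continuous_on_centred)

context
  assumes theta_pos: "\<theta> > 0"
begin

lemma covariance_centred:
  "expectation (\<lambda>\<omega>. centred s \<omega> * centred t \<omega>) = exp (- \<theta> * \<bar>s - t\<bar>) / (2 * \<theta>)"
  using wiener_isometry[OF centred_wiener_integral centred_wiener_integral, of s t]
    integral_OU_kernel_mult[OF theta_pos, of s t] by simp

lemma expectation_centred_square: "expectation (\<lambda>\<omega>. (centred t \<omega>)\<^sup>2) = 1 / (2 * \<theta>)"
  using covariance_centred[of t t] by (simp add: power2_eq_square)

lemma square_integrable_centred_integral:
  "square_integrable M (\<lambda>\<omega>. LBINT t:{a..b}. centred t \<omega>)"
  by (rule square_integrable_time_integral[OF square_integrable_centred continuous_on_centred])
     (auto simp: expectation_centred_square)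

lemma square_integrable_score: "square_integrable M (score S)"
  unfolding score_def[abs_def] Z_stat_def
  by (intro square_integrable_add square_integrable_cmult square_integrable_centred
      square_integrable_centred_integral)

lemma square_integrable_innovation: "square_integrable M (innovation S h)"
  unfolding innovation_def[abs_def]
  by (intro square_integrable_diff square_integrable_cmult square_integrable_centred)

text \<open>
  The score is a linear functional of the centred path, so covariances with it reduce to covariances
  with single values of the path.
\<close>

lemma expectation_mult_score:
  assumes Z: "square_integrable M Z"
  shows "expectation (\<lambda>\<omega>. Z \<omega> * score S \<omega>) = expectation (\<lambda>\<omega>. Z \<omega> * centred 0 \<omega>)
    + expectation (\<lambda>\<omega>. Z \<omega> * centred S \<omega>)
    + \<theta> * (LBINT t:{0..S}. expectation (\<lambda>\<omega>. Z \<omega> * centred t \<omega>))"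
proof -
  note [simp] = square_integrable_mult[OF Z square_integrable_centred]
    square_integrable_mult[OF Z square_integrable_centred_integral]
  have "expectation (\<lambda>\<omega>. Z \<omega> * score S \<omega>) = expectation (\<lambda>\<omega>. Z \<omega> * centred 0 \<omega>
      + Z \<omega> * centred S \<omega> + \<theta> * (Z \<omega> * (LBINT t:{0..S}. centred t \<omega>)))"
    by (simp add: score_def Z_stat_def algebra_simps)
  also have "\<dots> = expectation (\<lambda>\<omega>. Z \<omega> * centred 0 \<omega>) + expectation (\<lambda>\<omega>. Z \<omega> * centred S \<omega>)
      + \<theta> * expectation (\<lambda>\<omega>. Z \<omega> * (LBINT t:{0..S}. centred t \<omega>))"
    by simp
  also have "expectation (\<lambda>\<omega>. Z \<omega> * (LBINT t:{0..S}. centred t \<omega>))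
      = (LBINT t:{0..S}. expectation (\<lambda>\<omega>. Z \<omega> * centred t \<omega>))"
    by (rule expectation_mult_time_integral[OF centred_measurable square_integrable_centred
          eq_refl[OF expectation_centred_square] Z])
  finally show ?thesis .
qed

lemma expectation_score: "expectation (score S) = 0"
  using expectation_mult_score[OF square_integrable_const[of 1], of S]
  by (simp add: expectation_centred)

text \<open>
  The value does not depend on \<open>t\<close>: integrating the covariance over \<open>[0, S]\<close> leaves boundary terms
  \<open>exp (- \<theta> t)\<close> and \<open>exp (- \<theta> (S - t))\<close>, and the covariances with \<open>Y\<^sub>0\<close> and \<open>Y\<^sub>S\<close> cancel exactly these.
\<close>

lemma covariance_centred_score:
  assumes "0 \<le> t" "t \<le> S"
  shows "expectation (\<lambda>\<omega>. centred t \<omega> * score S \<omega>) = 1 / \<theta>"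
proof -
  have "(LBINT r:{0..S}. expectation (\<lambda>\<omega>. centred t \<omega> * centred r \<omega>))
      = (2 - exp (- \<theta> * t) - exp (- \<theta> * (S - t))) / \<theta> / (2 * \<theta>)"
    using integral_exp_abs_diff[OF theta_pos assms]
    by (simp add: covariance_centred abs_minus_commute)
  moreover have "expectation (\<lambda>\<omega>. centred t \<omega> * centred 0 \<omega>) = exp (- \<theta> * t) / (2 * \<theta>)"
    "expectation (\<lambda>\<omega>. centred t \<omega> * centred S \<omega>) = exp (- \<theta> * (S - t)) / (2 * \<theta>)"
    using assms unfolding covariance_centred by simp_all
  ultimately have "expectation (\<lambda>\<omega>. centred t \<omega> * score S \<omega>)
      = exp (- \<theta> * t) / (2 * \<theta>) + exp (- \<theta> * (S - t)) / (2 * \<theta>)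
        + \<theta> * ((2 - exp (- \<theta> * t) - exp (- \<theta> * (S - t))) / \<theta> / (2 * \<theta>))"
    by (simp only: expectation_mult_score[OF square_integrable_centred])
  also have "\<dots> = 1 / \<theta>"
  proof -
    have "p / (2 * \<theta>) + q / (2 * \<theta>) + \<theta> * ((2 - p - q) / \<theta> / (2 * \<theta>)) = 1 / \<theta>" for p q
    proof -
      have "\<theta> * ((2 - p - q) / \<theta> / (2 * \<theta>)) = (2 - p - q) / (2 * \<theta>)"
        using theta_pos by simp
      then show ?thesis
        by (simp add: add_divide_distrib[symmetric])
    qed
    then show ?thesis .
  qed
  finally show ?thesis .
qed

lemma expectation_score_square:
  assumes "0 \<le> S"
  shows "expectation (\<lambda>\<omega>. (score S \<omega>)\<^sup>2) = (2 + \<theta> * S) / \<theta>"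
proof -
  have "(LBINT t:{0..S}. expectation (\<lambda>\<omega>. score S \<omega> * centred t \<omega>)) = (LBINT t:{0..S}. 1 / \<theta>)"
    by (rule set_lebesgue_integral_cong) (auto simp: covariance_centred_score mult.commute[of "score S _" "centred _ _"])
  also have "\<dots> = S / \<theta>"
    using assms by (simp add: set_lebesgue_integral_def)
  finally have "expectation (\<lambda>\<omega>. score S \<omega> * score S \<omega>) = 1 / \<theta> + 1 / \<theta> + \<theta> * (S / \<theta>)"
    using assms covariance_centred_score[of 0 S] covariance_centred_score[of S S]
    by (simp add: expectation_mult_score[OF square_integrable_score] mult.commute[of "score S _" "centred _ _"])
  then show ?thesis
    using theta_pos by (simp add: power2_eq_square add_divide_distrib)
qed

lemma expectation_innovation: "expectation (innovation S h) = 0"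
  unfolding innovation_def[abs_def]
  by (simp add: expectation_centred integrable_if_square_integrable[OF square_integrable_centred])

text \<open>
  For \<open>t \<le> S\<close> the covariance kernel factorises, \<open>exp (- \<theta> (S + h - t)) = exp (- \<theta> h) exp (- \<theta> (S - t))\<close>;
  this is the Markov property at the level of second moments.
\<close>

lemma innovation_uncorrelated_past:
  assumes "t \<le> S" "0 \<le> h"
  shows "expectation (\<lambda>\<omega>. innovation S h \<omega> * centred t \<omega>) = 0"
proof -
  note [simp] = square_integrable_mult[OF square_integrable_centred square_integrable_centred]
  have "expectation (\<lambda>\<omega>. innovation S h \<omega> * centred t \<omega>) = expectation (\<lambda>\<omega>.
      centred (S + h) \<omega> * centred t \<omega> - exp (- \<theta> * h) * (centred S \<omega> * centred t \<omega>))"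
    by (simp add: innovation_def algebra_simps)
  also have "\<dots> = exp (- \<theta> * \<bar>S + h - t\<bar>) / (2 * \<theta>) - exp (- \<theta> * h) * (exp (- \<theta> * \<bar>S - t\<bar>) / (2 * \<theta>))"
    by (simp add: covariance_centred)
  also have "exp (- \<theta> * \<bar>S + h - t\<bar>) = exp (- \<theta> * h) * exp (- \<theta> * \<bar>S - t\<bar>)"
    using assms unfolding exp_add[symmetric] by (simp add: algebra_simps)
  finally show ?thesis by simp
qed

lemma innovation_uncorrelated_score:
  assumes "0 \<le> S" "0 \<le> h"
  shows "expectation (\<lambda>\<omega>. innovation S h \<omega> * score S \<omega>) = 0"
proof -
  have "(LBINT t:{0..S}. expectation (\<lambda>\<omega>. innovation S h \<omega> * centred t \<omega>)) = (LBINT t:{0..S}. 0)"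
    using assms by (intro set_lebesgue_integral_cong) (auto simp: innovation_uncorrelated_past)
  then show ?thesis
    using assms
    by (simp add: expectation_mult_score[OF square_integrable_innovation] innovation_uncorrelated_past)
qed

text \<open>
  Each of the two prediction errors has the form on the left, and the three terms are uncorrelated.
\<close>

lemma mean_square_affine_score:
  assumes "0 \<le> S" "0 \<le> h"
  shows "expectation (\<lambda>\<omega>. (\<alpha> * score S \<omega> + \<beta> - innovation S h \<omega>)\<^sup>2)
    = \<alpha>\<^sup>2 * ((2 + \<theta> * S) / \<theta>) + \<beta>\<^sup>2 + expectation (\<lambda>\<omega>. (innovation S h \<omega>)\<^sup>2)"
proof -
  let ?N = "score S" and ?R = "innovation S h"
  have [simp]: "integrable M ?N" "integrable M ?R" "integrable M (\<lambda>\<omega>. (?N \<omega>)\<^sup>2)"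
    "integrable M (\<lambda>\<omega>. (?R \<omega>)\<^sup>2)" "integrable M (\<lambda>\<omega>. ?R \<omega> * ?N \<omega>)"
    using square_integrable_score square_integrable_innovation
    by (auto intro: integrable_if_square_integrable square_integrable_mult simp: square_integrable_def)
  have "(\<alpha> * ?N \<omega> + \<beta> - ?R \<omega>)\<^sup>2 = \<alpha>\<^sup>2 * (?N \<omega>)\<^sup>2 + \<beta>\<^sup>2 + (?R \<omega>)\<^sup>2
      + 2 * \<alpha> * \<beta> * ?N \<omega> - 2 * \<beta> * ?R \<omega> - 2 * \<alpha> * (?R \<omega> * ?N \<omega>)" for \<omega>
    by (simp add: power2_eq_square algebra_simps)
  then show ?thesis
    using assms
    by (simp add: expectation_score_square expectation_score expectation_innovation
        innovation_uncorrelated_score prob_space)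
qed

lemma Z_stat_observation:
  assumes "\<omega> \<in> space M" "0 \<le> S"
  shows "Z_stat \<theta> S (\<lambda>t. X t \<omega>) = m * (2 + \<theta> * S) + score S \<omega>"
proof -
  have X: "X t \<omega> = m + centred t \<omega>" for t
    by (simp add: centred_def)
  have int: "set_integrable lborel {0..S} (\<lambda>t. centred t \<omega>)"
    by (intro borel_integrable_atLeastAtMost' continuous_on_subset[OF continuous_on_centred[OF assms(1)]]) simp
  have "(LBINT t:{0..S}. m + centred t \<omega>) = (LBINT t:{0..S}. m) + (LBINT t:{0..S}. centred t \<omega>)"
    by (rule set_integral_add(2)[OF borel_integrable_atLeastAtMost'[OF continuous_on_const] int])
  also have "(LBINT t:{0..S}. m) = m * S"
    using assms(2) by (simp add: set_lebesgue_integral_def)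
  finally show ?thesis
    unfolding X by (simp add: score_def Z_stat_def algebra_simps)
qed

lemma mean_square_ml_predictor:
  assumes "0 \<le> S" "0 \<le> h"
  shows "expectation (\<lambda>\<omega>. (ml_predictor \<theta> h S (\<lambda>t. X t \<omega>) - X (S + h) \<omega>)\<^sup>2)
    = (1 - exp (- \<theta> * h))\<^sup>2 * (1 / (\<theta> * (2 + \<theta> * S))) + expectation (\<lambda>\<omega>. (innovation S h \<omega>)\<^sup>2)"
proof -
  define D a where "D = 2 + \<theta> * S" and "a = 1 - exp (- \<theta> * h)"
  have D: "D > 0" using assms theta_pos by (simp add: D_def add_pos_nonneg)
  have "ml_predictor \<theta> h S (\<lambda>t. X t \<omega>) - X (S + h) \<omega> = a / D * score S \<omega> + 0 - innovation S h \<omega>"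
    if "\<omega> \<in> space M" for \<omega>
    using D
    by (simp add: ml_predictor_def ml_estimator_def Z_stat_observation[OF that assms(1)] innovation_def
        centred_def flip: D_def) (simp add: a_def field_simps)
  then have "expectation (\<lambda>\<omega>. (ml_predictor \<theta> h S (\<lambda>t. X t \<omega>) - X (S + h) \<omega>)\<^sup>2)
      = expectation (\<lambda>\<omega>. (a / D * score S \<omega> + 0 - innovation S h \<omega>)\<^sup>2)"
    by (intro Bochner_Integration.integral_cong) auto
  also have "\<dots> = (a / D)\<^sup>2 * (D / \<theta>) + 0\<^sup>2 + expectation (\<lambda>\<omega>. (innovation S h \<omega>)\<^sup>2)"
    unfolding mean_square_affine_score[OF assms] D_def ..
  also have "(a / D)\<^sup>2 * (D / \<theta>) = a\<^sup>2 * (1 / (\<theta> * D))"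
    using D by (simp add: field_simps power2_eq_square)
  finally show ?thesis by (simp add: a_def D_def)
qed

text \<open>
  Compared with the maximum likelihood estimator, the weight \<open>c\<close> of the prior shrinks the random part of
  the estimation error and introduces the bias \<open>c (m\<^sub>0 - m) / (2 + \<theta> S + c)\<close>.
\<close>

lemma mean_square_bayes_predictor:
  fixes u m0 :: real
  assumes "0 \<le> S" "0 \<le> h" "u > 0"
  defines "c \<equiv> inverse \<theta> * inverse (u\<^sup>2)"
  shows "expectation (\<lambda>\<omega>. (bayes_predictor \<theta> m0 u h S (\<lambda>t. X t \<omega>) - X (S + h) \<omega>)\<^sup>2)
    = (1 - exp (- \<theta> * h))\<^sup>2 * (((2 + \<theta> * S) / \<theta> + c\<^sup>2 * (m - m0)\<^sup>2) / (2 + \<theta> * S + c)\<^sup>2)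
      + expectation (\<lambda>\<omega>. (innovation S h \<omega>)\<^sup>2)"
proof -
  define D a where "D = 2 + \<theta> * S" and "a = 1 - exp (- \<theta> * h)"
  have c: "c > 0" using theta_pos assms(3) by (simp add: c_def)
  have D: "D > 0" using assms theta_pos by (simp add: D_def add_pos_nonneg)
  have Dc: "D + c \<noteq> 0" using D c by simp
  let ?\<beta> = "a * c * (m0 - m) / (D + c)"
  have "bayes_predictor \<theta> m0 u h S (\<lambda>t. X t \<omega>) - X (S + h) \<omega>
      = a / (D + c) * score S \<omega> + ?\<beta> - innovation S h \<omega>"
    if "\<omega> \<in> space M" for \<omega>
  proof -
    have "bayes_estimator \<theta> m0 u S (\<lambda>t. X t \<omega>) = (m * D + score S \<omega> + m0 * c) / (D + c)"
      by (simp add: bayes_estimator_def Z_stat_observation[OF that assms(1)] D_def c_def mult.assoc)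
    also have "\<dots> = m + (score S \<omega> + c * (m0 - m)) / (D + c)"
      using Dc by (simp add: field_simps)
    finally have "bayes_predictor \<theta> m0 u h S (\<lambda>t. X t \<omega>)
        = (m + (score S \<omega> + c * (m0 - m)) / (D + c)) * a + (1 - a) * X S \<omega>"
      by (simp add: bayes_predictor_def a_def)
    moreover have "a / (D + c) * score S \<omega> + ?\<beta> = (score S \<omega> + c * (m0 - m)) / (D + c) * a"
      by (simp add: add_divide_distrib[symmetric] algebra_simps)
    moreover have "innovation S h \<omega> = X (S + h) \<omega> - m - (1 - a) * (X S \<omega> - m)"
      by (simp add: innovation_def centred_def a_def)
    ultimately show ?thesis
      by (simp only:) (simp only: algebra_simps)
  qed
  then have "expectation (\<lambda>\<omega>. (bayes_predictor \<theta> m0 u h S (\<lambda>t. X t \<omega>) - X (S + h) \<omega>)\<^sup>2)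
      = expectation (\<lambda>\<omega>. (a / (D + c) * score S \<omega> + ?\<beta> - innovation S h \<omega>)\<^sup>2)"
    by (intro Bochner_Integration.integral_cong) auto
  also have "\<dots> = (a / (D + c))\<^sup>2 * (D / \<theta>) + ?\<beta>\<^sup>2 + expectation (\<lambda>\<omega>. (innovation S h \<omega>)\<^sup>2)"
    unfolding mean_square_affine_score[OF assms(1,2)] D_def ..
  also have "(a / (D + c))\<^sup>2 * (D / \<theta>) + ?\<beta>\<^sup>2 = a\<^sup>2 * ((D / \<theta> + c\<^sup>2 * (m - m0)\<^sup>2) / (D + c)\<^sup>2)"
    by (simp add: power_divide power_mult_distrib add_divide_distrib distrib_left power2_commute[of m0 m] mult_ac)
  finally show ?thesis by (simp add: a_def D_def)
qed

end

end

section \<open>Comparing the two mean square errors\<close>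

lemma mean_square_comparison:
  fixes D \<theta> c \<delta> :: real
  assumes "D > 0" "\<theta> > 0" "c > 0"
  shows "(D / \<theta> + c\<^sup>2 * \<delta>\<^sup>2) / (D + c)\<^sup>2 \<le> 1 / (\<theta> * D) \<longleftrightarrow> \<delta>\<^sup>2 \<le> 1 / (\<theta> * D) + 2 / (\<theta> * c)"
proof -
  have "(D / \<theta> + c\<^sup>2 * \<delta>\<^sup>2) / (D + c)\<^sup>2 \<le> 1 / (\<theta> * D)
      \<longleftrightarrow> D / \<theta> + c\<^sup>2 * \<delta>\<^sup>2 \<le> (D + c)\<^sup>2 / (\<theta> * D)"
    using assms by (simp add: pos_divide_le_eq)
  also have "(D + c)\<^sup>2 / (\<theta> * D) = D / \<theta> + c\<^sup>2 * (1 / (\<theta> * D) + 2 / (\<theta> * c))"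
    using assms by (simp add: field_simps power2_eq_square)
  also have "D / \<theta> + c\<^sup>2 * \<delta>\<^sup>2 \<le> D / \<theta> + c\<^sup>2 * (1 / (\<theta> * D) + 2 / (\<theta> * c))
      \<longleftrightarrow> \<delta>\<^sup>2 \<le> 1 / (\<theta> * D) + 2 / (\<theta> * c)"
    using assms by simp
  finally show ?thesis .
qed

theorem proposition6p1:
  fixes M :: "'a measure" and W X :: "real \<Rightarrow> 'a \<Rightarrow> real"
    and \<theta> m m0 u h :: real
  assumes "stationary_OU_process M W \<theta> m X"
    and "\<theta> > 0" and "u > 0" and "h > 0"
  shows "(\<forall>S>0. preferable M (X (S + h))
              (\<lambda>\<omega>. bayes_predictor \<theta> m0 u h S (\<lambda>t. X t \<omega>))
              (\<lambda>\<omega>. ml_predictor \<theta> h S (\<lambda>t. X t \<omega>))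
            \<longleftrightarrow> \<bar>m - m0\<bar> \<le> sqrt (1 / (\<theta> * (2 + \<theta> * S)) + 2 * u\<^sup>2))
       \<and> (\<bar>m - m0\<bar> \<le> u * sqrt 2 \<longrightarrow>
            (\<forall>S>0. preferable M (X (S + h))
              (\<lambda>\<omega>. bayes_predictor \<theta> m0 u h S (\<lambda>t. X t \<omega>))
              (\<lambda>\<omega>. ml_predictor \<theta> h S (\<lambda>t. X t \<omega>))))"
proof -
  interpret stationary_OU_process M W \<theta> m X by fact
  have iff: "preferable M (X (S + h))
              (\<lambda>\<omega>. bayes_predictor \<theta> m0 u h S (\<lambda>t. X t \<omega>))
              (\<lambda>\<omega>. ml_predictor \<theta> h S (\<lambda>t. X t \<omega>))
            \<longleftrightarrow> \<bar>m - m0\<bar> \<le> sqrt (1 / (\<theta> * (2 + \<theta> * S)) + 2 * u\<^sup>2)" if "S > 0" for S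
  proof -
    define c D a where "c = inverse \<theta> * inverse (u\<^sup>2)" and "D = 2 + \<theta> * S"
      and "a = 1 - exp (- \<theta> * h)"
    have "D > 0" "c > 0" using assms that by (auto simp: c_def D_def add_pos_nonneg)
    have "a > 0" using assms by (simp add: a_def)
    have "preferable M (X (S + h))
              (\<lambda>\<omega>. bayes_predictor \<theta> m0 u h S (\<lambda>t. X t \<omega>))
              (\<lambda>\<omega>. ml_predictor \<theta> h S (\<lambda>t. X t \<omega>))
        \<longleftrightarrow> a\<^sup>2 * ((D / \<theta> + c\<^sup>2 * (m - m0)\<^sup>2) / (D + c)\<^sup>2) \<le> a\<^sup>2 * (1 / (\<theta> * D))"
      using assms that
      by (simp only: preferable_def mean_square_ml_predictor mean_square_bayes_predictor less_imp_le
          a_def c_def D_def add_le_cancel_right)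
    also have "\<dots> \<longleftrightarrow> (D / \<theta> + c\<^sup>2 * (m - m0)\<^sup>2) / (D + c)\<^sup>2 \<le> 1 / (\<theta> * D)"
      using \<open>a > 0\<close> by (intro mult_le_cancel_left_pos) simp
    also have "\<dots> \<longleftrightarrow> (m - m0)\<^sup>2 \<le> 1 / (\<theta> * D) + 2 / (\<theta> * c)"
      by (rule mean_square_comparison) fact+
    also have "2 / (\<theta> * c) = 2 * u\<^sup>2"
      using assms by (simp add: c_def field_simps)
    also have "(m - m0)\<^sup>2 \<le> 1 / (\<theta> * D) + 2 * u\<^sup>2 \<longleftrightarrow> \<bar>m - m0\<bar> \<le> sqrt (1 / (\<theta> * D) + 2 * u\<^sup>2)"
      by (metis real_sqrt_abs real_sqrt_le_iff)
    finally show ?thesis by (simp only: D_def)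
  qed
  moreover have "\<bar>m - m0\<bar> \<le> sqrt (1 / (\<theta> * (2 + \<theta> * S)) + 2 * u\<^sup>2)"
    if "\<bar>m - m0\<bar> \<le> u * sqrt 2" "S > 0" for S
  proof -
    have "u * sqrt 2 = sqrt (2 * u\<^sup>2)"
      using assms by (simp add: real_sqrt_mult)
    also have "\<dots> \<le> sqrt (1 / (\<theta> * (2 + \<theta> * S)) + 2 * u\<^sup>2)"
      using assms that by simp
    finally show ?thesis using that by linarith
  qed
  ultimately show ?thesis by blast
qed

end
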